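(* Let $X\subset\{0,1\}^{\mathbb{N}}$ be the shift space $X=\overline{\bigcup_{n\ge0}X_n}$ defined in the context. Then every point $x\in X$ is a generic point for some $\sigma$-invariant ergodic Borel probability measure $\mu_x$ on $X$, and every ergodic $\sigma$-invariant Borel probability measure of $(X,\sigma)$ is supported on the orbit of a single periodic point.
   Context: $\mathbb{N}=\{1,2,\dots\}$; $\{0,1\}^{\mathbb{N}}$ carries the product topology and $\sigma$ is the shift map, $\sigma(x)_i=x_{i+1}$. A shift space is a closed $\sigma$-invariant subset. For blocks, $u^\infty=uuu\dots$, $0^\alpha$ is the block of $\alpha$ zeros ($0^0$ is the empty block), and $\|u\|_1$ is the number of $1$'s in $u$. A point $x$ is periodic if $\sigma^p(x)=x$ for some $p\ge1$. A point $x\in X$ is generic for a $\sigma$-invariant Borel probability measure $\mu$ if $\frac1n\sum_{j=0}^{n-1}f(\sigma^j(x))\to\int f\,d\mu$ for every continuous $f\colon X\to\mathbb{R}$. A block is a from-$1$-to-$1$ word if it equals $1$ or has the form $1v1$ with $v\in\{0,1\}^*$ (possibly empty). For a shift space $Y\subset\{0,1\}^{\mathbb{N}}$, $\mathcal{G}_m(Y)$ is the set of all from-$1$-to-$1$ words $u$ that occur in some point of $Y$ and satisfy $\|u\|_1\le m$. Construction of $X$: let $X_0=\{0^\infty\}\cup\{0^\alpha10^\infty:\alpha\ge0\}$. Given $X_n$ ($n\ge0$), let $$P_{n+1}=\bigcup_{l=0}^\infty\sigma^l\big(\{(u0^k)^\infty:k\ge2^{2n},\ u\in\mathcal{G}_{2^n}(X_n)\}\big),$$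 $$J'_{n+1}=\{0^\alpha u0^\infty:\alpha\ge0,\ u\in\mathcal{G}_{2^n}(X_n)\},$$ $$J''_{n+1}=\{0^\alpha u0^\beta v0^\infty:\alpha\ge0,\ \beta\ge2^{2n},\ u,v\in\mathcal{G}_{2^n}(X_n)\},$$ $J_{n+1}=J'_{n+1}\cup J''_{n+1}$, $Y_{n+1}=\overline{P_{n+1}\cup J_{n+1}}$, and $X_{n+1}=X_n\cup Y_{n+1}$. Finally $X=\overline{\bigcup_{n=0}^\infty X_n}$. *)

theory Defs
  imports "HOL-Probability.Probability" "HOL-Library.Omega_Words_Fun"
begin

(* Symbols 0 and 1 are False and True, and coordinates are numbered from 0.  The type
   bool word = nat => bool carries the product topology of the discrete type bool. *)

abbreviation shift :: "bool word \<Rightarrow> bool word" where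
  "shift \<equiv> suffix 1"

lemma shift_apply: "shift x i = x (i + 1)"
  by simp

lemma shift_funpow: "shift ^^ l = suffix l"
  by (induction l) (auto simp: fun_eq_iff)

definition zeros :: "nat \<Rightarrow> bool list" where
  "zeros k = replicate k False"

definition zero_word :: "bool word" where
  "zero_word = (\<lambda>_. False)"

definition ones :: "bool list \<Rightarrow> nat" where
  "ones u = count_list u True"

definition occurs_in :: "bool list \<Rightarrow> bool word \<Rightarrow> bool" where
  "occurs_in u x \<longleftrightarrow> (\<exists>i. x [i \<rightarrow> i + length u] = u)"

definition from_1_to_1 :: "bool list \<Rightarrow> bool" where
  "from_1_to_1 u \<longleftrightarrow> u = [True] \<or> (\<exists>v. u = [True] @ v @ [True])"

definition G :: "nat \<Rightarrow> bool word set \<Rightarrow> bool list set" where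
  "G m Y = {u. from_1_to_1 u \<and> (\<exists>x\<in>Y. occurs_in u x) \<and> ones u \<le> m}"

(* P_step n Y, J1_step n Y, J2_step n Y are P, J', J'' with index n + 1, built from Y = X_n. *)

definition P_step :: "nat \<Rightarrow> bool word set \<Rightarrow> bool word set" where
  "P_step n Y =
     (\<Union>l. (shift ^^ l) ` {(u @ zeros k)\<^sup>\<omega> | u k. k \<ge> 2 ^ (2 * n) \<and> u \<in> G (2 ^ n) Y})"

definition J1_step :: "nat \<Rightarrow> bool word set \<Rightarrow> bool word set" where
  "J1_step n Y = {(zeros \<alpha> @ u) \<frown> zero_word | \<alpha> u. u \<in> G (2 ^ n) Y}"

definition J2_step :: "nat \<Rightarrow> bool word set \<Rightarrow> bool word set" where
  "J2_step n Y =
     {(zeros \<alpha> @ u @ zeros \<beta> @ v) \<frown> zero_word | \<alpha> \<beta> u v.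
        \<beta> \<ge> 2 ^ (2 * n) \<and> u \<in> G (2 ^ n) Y \<and> v \<in> G (2 ^ n) Y}"

definition Y_step :: "nat \<Rightarrow> bool word set \<Rightarrow> bool word set" where
  "Y_step n Y = closure (P_step n Y \<union> (J1_step n Y \<union> J2_step n Y))"

primrec X_seq :: "nat \<Rightarrow> bool word set" where
  "X_seq 0 = {zero_word} \<union> {(zeros \<alpha> @ [True]) \<frown> zero_word | \<alpha>. True}"
| "X_seq (Suc n) = X_seq n \<union> Y_step n (X_seq n)"

definition X_lim :: "bool word set" where
  "X_lim = closure (\<Union>n. X_seq n)"

definition periodic_point :: "bool word \<Rightarrow> bool" where
  "periodic_point x \<longleftrightarrow> (\<exists>p\<ge>1. (shift ^^ p) x = x)"

definition orbit_of :: "bool word \<Rightarrow> bool word set" where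
  "orbit_of x = {(shift ^^ j) x | j. True}"

(* Measurability of the shift as a map from M to itself includes that it maps S into S. *)

definition invariant_prob_on :: "bool word set \<Rightarrow> bool word measure \<Rightarrow> bool" where
  "invariant_prob_on S M \<longleftrightarrow>
     space M = S \<and> sets M = sets (restrict_space borel S) \<and> prob_space M \<and>
     shift \<in> measurable M M \<and> distr M M shift = M"

definition ergodic_prob_on :: "bool word set \<Rightarrow> bool word measure \<Rightarrow> bool" where
  "ergodic_prob_on S M \<longleftrightarrow>
     invariant_prob_on S M \<and>
     (\<forall>A\<in>sets M. shift -` A \<inter> space M = A \<longrightarrow> measure M A = 0 \<or> measure M A = 1)"

definition generic_for :: "bool word set \<Rightarrow> bool word \<Rightarrow> bool word measure \<Rightarrow> bool" where
  "generic_for S x M \<longleftrightarrow>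
     x \<in> S \<and>
     (\<forall>f :: bool word \<Rightarrow> real. continuous_on S f \<longrightarrow>
        (\<lambda>n. (\<Sum>j<n. f ((shift ^^ j) x)) / real n) \<longlonglongrightarrow> integral\<^sup>L M f)"

end

theory Submission
  imports Defs
begin

text \<open>
  Every $x \in X$ either is eventually periodic or has ones of density zero. To see this, let $x$ have
  infinitely many ones and start with 1. If all prefixes of $x$ occur in one fixed $X_n$, then the long
  ones, having too many ones for the points of $X_0$, $J'$ and $J''$, are windows of periodic words
  $(u0^k)^\infty$ of bounded period, so $x$ is periodic. Otherwise a long prefix $w$ ending with 1 occurs
  for the first time in a step $X_{m+1}$ with $m$ large. Any window of length $2^{2m}$ in
  $P_{m+1} \cup J_{m+1}$ meets at most one of the blocks $u \in \mathcal{G}_{2^m}(X_m)$. Hence such a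
  window has at most $2^m$ ones, and $w$ is longer than $2^{2m}$, as it would otherwise lie in a block
  and occur in $X_m$. So the density of ones in $w$ is at most $2 / 2^m$.

  In the first case $x$ is generic for a measure on a periodic orbit, in the second for $\delta_{0^\infty}$.
  An ergodic measure with a periodic atom lives on the orbit of this atom. If there is no such atom,
  almost every point is not eventually periodic, since there are only countably many periodic points;
  then by dominated convergence the set $\{x_0 = 1\}$ is null and the measure is $\delta_{0^\infty}$.
\<close>

subsection \<open>Topology of the full shift\<close>

text \<open>Only finitely many coordinates are constrained, each by a clopen condition. The offset
  \<open>i\<close> separates the place of the window from the prefix of \<open>x\<close> it shows,
  so that an occurrence of that prefix at \<open>i\<close> is an open condition on
  \<open>y\<close>.\<close>

lemma open_cylinder: "open {y :: bool word. \<forall>j<L. y (i + j) = x j}"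
proof -
  have "open ((\<lambda>y :: bool word. y (i + j)) -` {x j})" for j
    by (rule open_vimage) (simp_all add: Topological_Spaces.open_discrete)
  then have "open (\<Inter>j<L. (\<lambda>y :: bool word. y (i + j)) -` {x j})"
    by (intro open_INT) auto
  also have "(\<Inter>j<L. (\<lambda>y :: bool word. y (i + j)) -` {x j}) = {y. \<forall>j<L. y (i + j) = x j}"
    by auto
  finally show ?thesis .
qed

text \<open>A basic open box of the product restricts finitely many coordinates, and all of them lie
  below some \<open>N\<close>.\<close>

lemma open_contains_cylinder:
  fixes x :: "bool word"
  assumes "open A" "x \<in> A"
  obtains N where "\<And>y. (\<And>i. i < N \<Longrightarrow> y i = x i) \<Longrightarrow> y \<in> A"
proof -
  from assms have "openin (product_topology (\<lambda>_. euclidean) UNIV) A"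
    by (simp add: euclidean_product_topology)
  from product_topology_open_contains_basis[OF this \<open>x \<in> A\<close>]
  obtain U where U: "x \<in> PiE UNIV U" "finite {i. U i \<noteq> UNIV}" "PiE UNIV U \<subseteq> A"
    by auto
  from U(2) obtain N where N: "\<And>i. U i \<noteq> UNIV \<Longrightarrow> i < N"
    by (metis (mono_tags, lifting) finite_nat_bounded lessThan_iff mem_Collect_eq subsetD)
  show thesis
  proof
    fix y assume "\<And>i. i < N \<Longrightarrow> y i = x i"
    then have "y i \<in> U i" for i
      using U(1) N[of i] by (cases "U i = UNIV") (auto simp: PiE_iff)
    then show "y \<in> A" using U(3) by (auto simp: PiE_iff)
  qed
qed

lemma closed_singleton_word: "closed {x :: bool word}"
proof -
  have "open (- {x})"
  proof (subst open_subopen, intro ballI)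
    fix y assume "y \<in> - {x}"
    then obtain i where "y i \<noteq> x i" by (auto simp: fun_eq_iff)
    then show "\<exists>T. open T \<and> y \<in> T \<and> T \<subseteq> - {x}"
      using open_cylinder[of "Suc i" 0 y] by (intro exI[of _ "{z. \<forall>j<Suc i. z (0 + j) = y j}"]) auto
  qed
  then show ?thesis by (simp add: closed_def)
qed

lemma compact_UNIV_word: "compact (UNIV :: bool word set)"
proof -
  have "compact_space (euclidean :: bool topology)"
    by (simp add: compact_space_def finite_imp_compact)
  then have "compact_space (product_topology (\<lambda>_ :: nat. euclidean :: bool topology) UNIV)"
    by (simp add: compact_space_product_topology)
  then show ?thesis
    by (simp add: euclidean_product_topology compact_space_def)
qed

lemma continuous_on_suffix: "continuous_on S (suffix k :: bool word \<Rightarrow> bool word)"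
  unfolding suffix_def[abs_def]
  by (intro continuous_on_coordinatewise_then_product continuous_on_subset[OF continuous_on_product_coordinates]) auto

subsection \<open>Orbit averages\<close>

text \<open>The deviations of \<open>g\<close> from its mean over one period cancel along each
  period beyond \<open>a\<close>. Their partial sums \<open>H\<close> are therefore eventually
  periodic, hence bounded, and vanish after division by \<open>n\<close>.\<close>

lemma Cesaro_mean_periodic:
  fixes g :: "nat \<Rightarrow> real"
  assumes p: "p \<ge> 1" and per: "\<And>j. j \<ge> a \<Longrightarrow> g (j + p) = g j"
  shows "(\<lambda>n. (\<Sum>j<n. g j) / real n) \<longlonglongrightarrow> (\<Sum>j<p. g (a + j)) / real p"
proof -
  define A where "A = (\<Sum>j<p. g (a + j)) / real p"
  define H where "H n = (\<Sum>j<n. g j - A)" for n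
  have step: "H (n + p) = H n" if "n \<ge> a" for n
    using that
  proof (induction n rule: dec_induct)
    case base
    have "H (a + m) = H a + (\<Sum>j<m. g (a + j) - A)" for m
      by (induction m) (simp_all add: H_def)
    from this[of p] have "H (a + p) = H a + (\<Sum>j<p. g (a + j) - A)" .
    then show ?case using p by (simp add: A_def sum_subtractf)
  next
    case (step n)
    then show ?case using per[of n] by (simp add: H_def)
  qed
  have H_range: "H (a + q * p + r) = H (a + r)" for q r
  proof (induction q)
    case (Suc q)
    have "H (a + Suc q * p + r) = H ((a + q * p + r) + p)" by (simp add: algebra_simps)
    then show ?case using step[of "a + q * p + r"] Suc by simp
  qed simp
  \<comment> \<open>Every value of \<open>H\<close> beyond \<open>a + p\<close> repeats one taken
    between \<open>a\<close> and \<open>a + p\<close>, so this finite maximum bounds all of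
    \<open>H\<close>.\<close>
  define B where "B = Max ((\<lambda>n. \<bar>H n\<bar>) ` {..a + p})"
  have H_bound: "\<bar>H n\<bar> \<le> B" for n
  proof (cases "n \<le> a + p")
    case True
    then show ?thesis unfolding B_def by (intro Max_ge) auto
  next
    case False
    then have "H n = H (a + (n - a) mod p)"
      using H_range[of "(n - a) div p" "(n - a) mod p"] by simp
    moreover have "a + (n - a) mod p \<le> a + p"
      using p by (simp add: less_imp_le)
    ultimately show ?thesis unfolding B_def by (intro Max_ge) auto
  qed
  have "(\<lambda>n. H n * (1 / real n)) \<longlonglongrightarrow> 0"
    by (rule lim_null_mult_left_bounded[where B = B]) (auto simp: H_bound lim_1_over_n)
  then have "(\<lambda>n. H n / real n + A) \<longlonglongrightarrow> 0 + A"
    by (intro tendsto_add) auto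
  moreover have "\<forall>\<^sub>F n in sequentially. H n / real n + A = (\<Sum>j<n. g j) / real n"
    using eventually_gt_at_top[of 0]
    by eventually_elim (simp add: H_def sum_subtractf field_simps)
  ultimately show ?thesis
    unfolding A_def[symmetric] by (auto elim: Lim_transform_eventually)
qed

abbreviation ones_before :: "nat \<Rightarrow> bool word \<Rightarrow> nat" where
  "ones_before n x \<equiv> card {j. j < n \<and> x j}"

text \<open>Union bound over the \<open>N\<close> offsets \<open>i\<close>; translating by
  \<open>i\<close> moves at most \<open>N\<close> further ones into view, those at places from
  \<open>n\<close> to \<open>n + N - 1\<close>.\<close>

lemma card_shifted_ones_le:
  "card {j. j < n \<and> (\<exists>i<N. x (j + i))} \<le> N * (ones_before n x + N)"
proof -
  have "card {j. j < n \<and> x (j + i)} \<le> ones_before n x + N" if "i < N" for i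
  proof -
    have "card {j. j < n \<and> x (j + i)} = card ((\<lambda>j. j + i) ` {j. j < n \<and> x (j + i)})"
      by (rule card_image[symmetric]) auto
    also have "\<dots> \<le> card ({j. j < n \<and> x j} \<union> {n..<n + N})"
      using that by (intro card_mono) auto
    also have "\<dots> \<le> ones_before n x + card {n..<n + N}"
      by (rule card_Un_le)
    finally show ?thesis by simp
  qed
  then have "(\<Sum>i<N. card {j. j < n \<and> x (j + i)}) \<le> (\<Sum>i<N. ones_before n x + N)"
    by (intro sum_mono) auto
  moreover have "{j. j < n \<and> (\<exists>i<N. x (j + i))} = (\<Union>i<N. {j. j < n \<and> x (j + i)})"
    by auto
  ultimately show ?thesis
    using card_UN_le[of "{..<N}" "\<lambda>i. {j. j < n \<and> x (j + i)}"] by simp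
qed

text \<open>Density zero of the ones is the property that makes a point generic for the point mass
  at \<open>zero_word\<close>.\<close>

definition sparse :: "bool word \<Rightarrow> bool" where
  "sparse x \<longleftrightarrow> (\<lambda>n. real (ones_before n x) / real n) \<longlonglongrightarrow> 0"

text \<open>By continuity, \<open>f\<close> is within \<open>e / 2\<close> of
  \<open>f zero_word\<close> at every time \<open>j\<close> whose window of length \<open>N\<close>
  shows only zeros. The remaining times have density zero by \<open>card_shifted_ones_le\<close>,
  and there boundedness of \<open>f\<close> on the compact set \<open>S\<close> suffices.\<close>

lemma sparse_orbit_mean:
  fixes f :: "bool word \<Rightarrow> real"
  assumes S: "compact S" "zero_word \<in> S" "\<And>j. suffix j x \<in> S"
    and f: "continuous_on S f" and x: "sparse x"
  shows "(\<lambda>n. (\<Sum>j<n. f (suffix j x)) / real n) \<longlonglongrightarrow> f zero_word"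
proof (rule LIMSEQ_I)
  fix e :: real assume e: "e > 0"
  obtain B where B: "\<And>y. y \<in> S \<Longrightarrow> \<bar>f y\<bar> \<le> B"
    using compact_imp_bounded[OF compact_continuous_image[OF f S(1)]] by (auto simp: bounded_iff)
  define g where "g j = \<bar>f (suffix j x) - f zero_word\<bar>" for j
  have g_bound: "g j \<le> 2 * B" for j
    using B[OF S(2)] B[OF S(3)[of j]] unfolding g_def by linarith
  have B0: "B \<ge> 0" using B[OF S(2)] by simp
  obtain T where T: "open T" "T \<inter> S = f -` {f zero_word - e / 2 <..< f zero_word + e / 2} \<inter> S"
    using f unfolding continuous_on_open_invariant by (meson open_greaterThanLessThan)
  have "zero_word \<in> T" using T(2) S(2) e by auto
  then obtain N where N: "\<And>y. (\<And>i. i < N \<Longrightarrow> y i = zero_word i) \<Longrightarrow> y \<in> T"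
    using open_contains_cylinder[OF T(1)] by metis
  have g_small: "g j \<le> e / 2" if "\<not> (\<exists>i<N. x (j + i))" for j
  proof -
    have "suffix j x \<in> T" using that by (intro N) (auto simp: zero_word_def)
    then have "suffix j x \<in> f -` {f zero_word - e / 2 <..< f zero_word + e / 2}"
      using T(2) S(3)[of j] by blast
    then show ?thesis by (auto simp: g_def abs_if)
  qed
  define c where "c n = real (ones_before n x)" for n
  have sum_bound: "(\<Sum>j<n. g j) \<le> real n * (e / 2) + 2 * B * (real N * (c n + real N))" for n
  proof -
    have "(\<Sum>j<n. g j) \<le> (\<Sum>j<n. e / 2 + (if \<exists>i<N. x (j + i) then 2 * B else 0))"
      using g_small g_bound e by (intro sum_mono) (auto intro: add_increasing)
    also have "\<dots> = real n * (e / 2) + 2 * B * real (card {j. j < n \<and> (\<exists>i<N. x (j + i))})"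
      by (simp add: sum.distrib sum.If_cases Int_def lessThan_def)
    also have "\<dots> \<le> real n * (e / 2) + 2 * B * real (N * (ones_before n x + N))"
      using B0 card_shifted_ones_le[of n N x] by (intro add_left_mono mult_left_mono of_nat_mono) auto
    finally show ?thesis by (simp add: c_def)
  qed
  have "(\<lambda>n. 2 * B * real N * (c n / real n) + 2 * B * real N * real N * (1 / real n))
          \<longlonglongrightarrow> 2 * B * real N * 0 + 2 * B * real N * real N * 0"
    using x lim_1_over_n unfolding sparse_def c_def by (intro tendsto_intros) auto
  then have "\<forall>\<^sub>F n in sequentially.
      2 * B * real N * (c n / real n) + 2 * B * real N * real N * (1 / real n) < e / 2"
    using e by (intro order_tendstoD(2)) auto
  then obtain n0 where n0: "\<And>n. n \<ge> n0 \<Longrightarrow>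
      2 * B * real N * (c n / real n) + 2 * B * real N * real N * (1 / real n) < e / 2"
    by (auto simp: eventually_sequentially)
  show "\<exists>no. \<forall>n\<ge>no. norm ((\<Sum>j<n. f (suffix j x)) / real n - f zero_word) < e"
  proof (intro exI[of _ "max 1 n0"] allI impI)
    fix n assume n: "max 1 n0 \<le> n"
    then have n_pos: "real n > 0" by auto
    have "(\<Sum>j<n. f (suffix j x)) / real n - f zero_word
        = (\<Sum>j<n. f (suffix j x) - f zero_word) / real n"
      using n_pos by (simp add: sum_subtractf field_simps)
    then have "norm ((\<Sum>j<n. f (suffix j x)) / real n - f zero_word) \<le> (\<Sum>j<n. g j) / real n"
      using n_pos unfolding g_def by (simp add: divide_right_mono)
    also have "\<dots> \<le> (real n * (e / 2) + 2 * B * (real N * (c n + real N))) / real n"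
      using n_pos sum_bound[of n] by (intro divide_right_mono) auto
    also have "\<dots> = e / 2 + (2 * B * real N * (c n / real n) + 2 * B * real N * real N * (1 / real n))"
      using n_pos by (simp add: field_simps)
    also have "\<dots> < e / 2 + e / 2"
      using n0[of n] n by (intro add_strict_left_mono) auto
    finally show "norm ((\<Sum>j<n. f (suffix j x)) / real n - f zero_word) < e" by simp
  qed
qed

subsection \<open>Measures on periodic orbits\<close>

text \<open>The uniform measure on the orbit of \<open>q\<close>, as the image of the uniform
  measure on the indices. If \<open>p\<close> is a multiple of the least period, all orbit points
  are hit equally often, so the measure is the same.\<close>

definition orbit_measure :: "bool word set \<Rightarrow> nat \<Rightarrow> bool word \<Rightarrow> bool word measure" where
  "orbit_measure S p q =
     distr (measure_pmf (pmf_of_set {..<p})) (restrict_space borel S) (\<lambda>j. suffix j q)"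

lemma measurable_suffix_restrict:
  fixes S :: "bool word set"
  assumes "\<And>y. y \<in> S \<Longrightarrow> suffix k y \<in> S"
  shows "suffix k \<in> measurable (restrict_space borel S) (restrict_space borel S)"
  using assms borel_measurable_continuous_on_restrict[OF continuous_on_suffix]
  by (intro measurable_restrict_space2) (simp_all add: space_restrict_space del: suffix_nth)

lemma suffix_mod_period:
  assumes "suffix p q = q"
  shows "suffix j q = suffix (j mod p) q"
proof -
  have "suffix (p * m) q = q" for m
  proof (induction m)
    case (Suc m)
    have "suffix (p * Suc m) q = suffix (p * m) (suffix p q)"
      by (simp add: add.commute)
    then show ?case using Suc assms by simp
  qed simp
  then have "suffix (j mod p) (suffix (p * (j div p)) q) = suffix (j mod p) q" by simp
  then show ?thesis by (simp add: add.commute)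
qed

text \<open>On indices the shift acts as the rotation \<open>Suc j mod p\<close>, which preserves
  the uniform measure. An invariant set contains either the whole orbit of \<open>q\<close> or none
  of it, so it has measure 1 or 0.\<close>

lemma ergodic_orbit_measure:
  assumes p: "p \<ge> 1" and per: "suffix p q = q" and S: "\<And>y. y \<in> S \<Longrightarrow> shift y \<in> S" and q: "q \<in> S"
  shows "ergodic_prob_on S (orbit_measure S p q)"
proof -
  let ?M = "orbit_measure S p q" and ?R = "restrict_space borel S"
  have orbit: "suffix j q \<in> S" for j
  proof (induction j)
    case (Suc j)
    then show ?case using S[of "suffix j q"] by (simp del: suffix_nth)
  qed (simp add: q)
  have ne: "{..<p} \<noteq> {}" using p by (simp add: lessThan_empty_iff)
  have meas: "(\<lambda>j. suffix (f j) q) \<in> measurable (measure_pmf (pmf_of_set {..<p})) ?R" for f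
    using orbit by (auto simp: space_restrict_space)
  have space: "space ?M = S" and sets: "sets ?M = sets ?R"
    by (auto simp: orbit_measure_def space_restrict_space)
  have shift_meas: "shift \<in> measurable ?R ?R"
    by (rule measurable_suffix_restrict[OF S])
  have prob: "prob_space ?M"
    unfolding orbit_measure_def by (rule measure_pmf.prob_space_distr) (rule meas)
  have "bij_betw (\<lambda>j. Suc j mod p) {..<p} {..<p}"
  proof (rule bij_betwI[where g = "\<lambda>j. (j + (p - 1)) mod p"])
    show "(Suc j mod p + (p - 1)) mod p = j" if "j \<in> {..<p}" for j
    proof -
      have "(Suc j mod p + (p - 1)) mod p = (j + p) mod p"
        using p by (simp only: mod_add_left_eq) simp
      then show ?thesis using that by simp
    qed
    show "Suc ((j + (p - 1)) mod p) mod p = j" if "j \<in> {..<p}" for j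
    proof -
      have "Suc ((j + (p - 1)) mod p) mod p = (j + p) mod p"
        using p by (simp add: mod_Suc_eq)
      then show ?thesis using that by simp
    qed
  qed (use p in auto)
  then have pmf: "map_pmf (\<lambda>j. Suc j mod p) (pmf_of_set {..<p}) = pmf_of_set {..<p}"
    using ne by (intro map_pmf_of_set_bij_betw) auto
  have "distr ?M ?R shift = distr (measure_pmf (pmf_of_set {..<p})) ?R (shift \<circ> (\<lambda>j. suffix j q))"
    unfolding orbit_measure_def by (rule distr_distr[OF shift_meas meas])
  also have "shift \<circ> (\<lambda>j. suffix j q) = (\<lambda>j. suffix j q) \<circ> (\<lambda>j. Suc j mod p)"
    using suffix_mod_period[OF per] by (auto simp: fun_eq_iff simp del: suffix_nth)
  also have "distr (measure_pmf (pmf_of_set {..<p})) ?R \<dots>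
      = distr (distr (measure_pmf (pmf_of_set {..<p})) (count_space UNIV) (\<lambda>j. Suc j mod p)) ?R (\<lambda>j. suffix j q)"
    using orbit by (intro distr_distr[symmetric]) (auto simp: space_restrict_space)
  also have "\<dots> = ?M"
    unfolding map_pmf_rep_eq[symmetric] pmf orbit_measure_def ..
  finally have inv: "distr ?M ?M shift = ?M"
    using distr_cong[OF refl sets, of ?M shift shift] by (simp del: suffix_nth One_nat_def)
  have "measure ?M A = 0 \<or> measure ?M A = 1" if A: "A \<in> sets ?M" "shift -` A \<inter> space ?M = A" for A
  proof -
    have "suffix j q \<in> A \<longleftrightarrow> q \<in> A" for j
    proof (induction j)
      case (Suc j)
      have "suffix j q \<in> A \<longleftrightarrow> shift (suffix j q) \<in> A"
        using A(2) orbit[of j] unfolding space by blast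
      then show ?case using Suc by (simp del: suffix_nth)
    qed simp
    then have "(\<lambda>j. suffix j q) -` A = (if q \<in> A then UNIV else {})" by auto
    then have "measure ?M A = (if q \<in> A then 1 else 0)"
      using A(1) meas[of "\<lambda>j. j"] unfolding sets unfolding orbit_measure_def
      by (subst measure_distr) auto
    then show ?thesis by auto
  qed
  moreover have "shift \<in> measurable ?M ?M"
    using shift_meas measurable_cong_sets[OF sets sets] by auto
  ultimately show ?thesis
    unfolding ergodic_prob_on_def invariant_prob_on_def using space sets prob inv by auto
qed

lemma integral_orbit_measure:
  fixes f :: "bool word \<Rightarrow> real"
  assumes p: "p \<ge> 1" and orbit: "\<And>j. suffix j q \<in> S" and f: "continuous_on S f"
  shows "integral\<^sup>L (orbit_measure S p q) f = (\<Sum>j<p. f (suffix j q)) / real p"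
proof -
  have "{..<p} \<noteq> {}" using p by (simp add: lessThan_empty_iff)
  then show ?thesis
    unfolding orbit_measure_def using orbit
    by (subst integral_distr)
      (auto simp: space_restrict_space integral_pmf_of_set intro: borel_measurable_continuous_on_restrict[OF f])
qed

text \<open>A point of period \<open>p\<close> is determined by its first \<open>p\<close> symbols,
  and there are countably many lists.\<close>

lemma countable_periodic_points: "countable {x. periodic_point x}"
proof -
  have "countable {x :: bool word. suffix p x = x}" if "p \<ge> 1" for p
  proof (rule countable_image_inj_on)
    show "countable ((\<lambda>x. map x [0..<p]) ` {x :: bool word. suffix p x = x})"
      by (rule countableI_type)
    show "inj_on (\<lambda>x. map x [0..<p]) {x :: bool word. suffix p x = x}"
    proof (rule inj_onI, rule ext)
      fix x y :: "bool word" and i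
      assume *: "x \<in> {x. suffix p x = x}" "y \<in> {x. suffix p x = x}" "map x [0..<p] = map y [0..<p]"
      have "x i = x (i mod p)" "y i = y (i mod p)"
        using fun_cong[OF suffix_mod_period[of p x i], of 0] fun_cong[OF suffix_mod_period[of p y i], of 0] *
        by simp_all
      moreover have "x (i mod p) = y (i mod p)"
        using * that by (auto simp: list_eq_iff_nth_eq)
      ultimately show "x i = y i" by simp
    qed
  qed
  then have "countable (\<Union>p\<in>{1..}. {x :: bool word. suffix p x = x})" by auto
  moreover have "{x. periodic_point x} = (\<Union>p\<in>{1..}. {x :: bool word. suffix p x = x})"
    by (auto simp: periodic_point_def shift_funpow simp del: One_nat_def)
  ultimately show ?thesis by simp
qed

subsection \<open>Words occurring in the construction\<close>

text \<open>Occurrence of the first \<open>L\<close> symbols of \<open>x\<close> in a point of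
  \<open>S\<close>, expressed by coordinates instead of lists so that it matches the open sets of
  \<open>open_cylinder\<close>.\<close>

definition prefix_occurs :: "nat \<Rightarrow> bool word \<Rightarrow> bool word set \<Rightarrow> bool" where
  "prefix_occurs L x S \<longleftrightarrow> (\<exists>y\<in>S. \<exists>i. \<forall>j<L. y (i + j) = x j)"

text \<open>The set whose closure is $Y_{m+1}$: its points have explicit coordinates.\<close>

definition step_points :: "nat \<Rightarrow> bool word set" where
  "step_points m = P_step m (X_seq m) \<union> (J1_step m (X_seq m) \<union> J2_step m (X_seq m))"

section \<open>Counting ones in prefixes\<close>

lemma ones_before_add:
  "ones_before (m + n) x = ones_before m x + ones_before n (suffix m x)"
proof -
  have "{j. j < m + n \<and> x j} = {j. j < m \<and> x j} \<union> (\<lambda>j. m + j) ` {j. j < n \<and> suffix m x j}"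
    by (auto simp: image_iff intro: less_imp_add_positive) (metis add_less_cancel_left le_add_diff_inverse linorder_not_less)
  then show ?thesis
    by (simp only:) (subst card_Un_disjoint; auto simp: card_image)
qed

lemma ones_before_mono: "m \<le> n \<Longrightarrow> ones_before m x \<le> ones_before n x"
  by (intro card_mono) auto

lemma ones_before_le: "ones_before n x \<le> n"
  using card_mono[of "{..<n}" "{j. j < n \<and> x j}"] by auto

lemma ones_before_cong: "(\<And>j. j < n \<Longrightarrow> x j = y j) \<Longrightarrow> ones_before n x = ones_before n y"
  by (rule arg_cong[where f = card]) auto

text \<open>The first \<open>n\<close> places are covered by \<open>n div K + 1\<close> consecutive
  windows of length \<open>K\<close>.\<close>

lemma ones_before_le_windows:
  assumes "\<And>i. ones_before K (suffix i x) \<le> c" "K > 0"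
  shows "ones_before n x \<le> c * (n div K + 1)"
proof -
  have "ones_before (q * K) x \<le> c * q" for q
  proof (induction q)
    case (Suc q)
    have "ones_before (Suc q * K) x = ones_before (q * K) x + ones_before K (suffix (q * K) x)"
      using ones_before_add[of "q * K" K x] by (simp add: add.commute)
    then show ?case using Suc assms(1)[of "q * K"] by simp
  qed simp
  from this[of "n div K + 1"] show ?thesis
    using ones_before_mono[of n "(n div K + 1) * K" x] dividend_less_div_times[OF assms(2), of n]
    by simp
qed

lemma sparse_suffixD:
  assumes "sparse (suffix a x)"
  shows "sparse x"
  unfolding sparse_def
proof (rule Lim_null_comparison)
  show "\<forall>\<^sub>F n in sequentially. norm (real (ones_before n x) / real n)
      \<le> real a * (1 / real n) + real (ones_before n (suffix a x)) / real n"
  proof (rule always_eventually, rule allI)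
    fix n
    have "ones_before n x \<le> a + ones_before n (suffix a x)"
      using ones_before_mono[of n "a + n" x] ones_before_add[of a n x] ones_before_le[of a x] by linarith
    then have "real (ones_before n x) / real n \<le> real (a + ones_before n (suffix a x)) / real n"
      by (intro divide_right_mono of_nat_mono) auto
    then show "norm (real (ones_before n x) / real n)
      \<le> real a * (1 / real n) + real (ones_before n (suffix a x)) / real n"
      by (simp add: add_divide_distrib)
  qed
  have "(\<lambda>n. real a * (1 / real n) + real (ones_before n (suffix a x)) / real n)
      \<longlonglongrightarrow> real a * 0 + 0"
    using assms lim_1_over_n unfolding sparse_def by (intro tendsto_intros) auto
  then show "(\<lambda>n. real a * (1 / real n) + real (ones_before n (suffix a x)) / real n) \<longlonglongrightarrow> 0"
    by simp
qed

lemma sparse_finite: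
  assumes "finite {j. x j}"
  shows "sparse x"
  unfolding sparse_def
proof (rule Lim_null_comparison)
  show "\<forall>\<^sub>F n in sequentially. norm (real (ones_before n x) / real n)
      \<le> real (card {j. x j}) * (1 / real n)"
  proof (rule always_eventually, rule allI)
    fix n
    have "ones_before n x \<le> card {j. x j}"
      using assms by (intro card_mono) auto
    then show "norm (real (ones_before n x) / real n) \<le> real (card {j. x j}) * (1 / real n)"
      by (simp add: divide_right_mono)
  qed
  show "(\<lambda>n. real (card {j. x j}) * (1 / real n)) \<longlonglongrightarrow> 0"
    using tendsto_mult_right_zero[OF lim_1_over_n] by auto
qed

text \<open>An open cylinder that meets the closure already meets the set, so limit points
  contribute no new finite words.\<close>

lemma prefix_occurs_closure: "prefix_occurs L x (closure S) \<Longrightarrow> prefix_occurs L x S"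
proof -
  assume "prefix_occurs L x (closure S)"
  then obtain i where "{y. \<forall>j<L. y (i + j) = x j} \<inter> closure S \<noteq> {}"
    unfolding prefix_occurs_def by auto
  then have "{y. \<forall>j<L. y (i + j) = x j} \<inter> S \<noteq> {}"
    by (simp add: open_Int_closure_eq_empty[OF open_cylinder])
  then show ?thesis unfolding prefix_occurs_def by auto
qed

lemma prefix_occurs_mono:
  "prefix_occurs L x S \<Longrightarrow> L' \<le> L \<Longrightarrow> S \<subseteq> T \<Longrightarrow> prefix_occurs L' x T"
  unfolding prefix_occurs_def by (meson order_less_le_trans subsetD)

section \<open>Blocks and the coordinates of the points built from them\<close>

lemma from_1_to_1_iff: "from_1_to_1 u \<longleftrightarrow> u \<noteq> [] \<and> hd u \<and> last u"
proof
  assume *: "u \<noteq> [] \<and> hd u \<and> last u"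
  then obtain w where w: "u = True # w" by (cases u) auto
  show "from_1_to_1 u"
  proof (cases w rule: rev_cases)
    case (snoc v b)
    then show ?thesis using * w by (auto simp: from_1_to_1_def)
  qed (use w in \<open>simp add: from_1_to_1_def\<close>)
qed (auto simp: from_1_to_1_def)

lemma ones_eq_card: "ones u = card {i. i < length u \<and> u ! i}"
  by (simp add: ones_def count_list_eq_length_filter length_filter_conv_card)

lemma G_occurs:
  assumes "u \<in> G m Y"
  obtains x i where "x \<in> Y" "\<And>j. j < length u \<Longrightarrow> x (i + j) = u ! j"
proof -
  from assms obtain x i where x: "x \<in> Y" "x [i \<rightarrow> i + length u] = u"
    unfolding G_def occurs_in_def by auto
  have "x (i + j) = u ! j" if "j < length u" for j
  proof -
    have "x [i \<rightarrow> i + length u] ! j = x (i + j)" using that by simp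
    then show ?thesis unfolding x(2) by simp
  qed
  with x(1) show thesis by (rule that)
qed

text \<open>Prepares shift invariance: once its leading 1 is removed, a block is empty or consists
  of zeros followed by a shorter block, which occurs in the same point and has fewer ones.\<close>

lemma G_tail:
  assumes u: "u \<in> G m Y"
  obtains "u = [True]" | j u' where "u = True # zeros j @ u'" "u' \<in> G m Y"
proof (cases "u = [True]")
  case False
  with u obtain v where v: "u = True # v @ [True]"
    unfolding G_def from_1_to_1_def by auto
  define w where "w = v @ [True]"
  define u' where "u' = dropWhile Not w"
  define j where "j = length (takeWhile Not w)"
  have "u' \<noteq> []" unfolding u'_def w_def by simp
  have "takeWhile Not w = zeros j"
    unfolding zeros_def j_def by (rule replicate_length_same[symmetric]) (auto dest: set_takeWhileD)
  then have w_split: "w = zeros j @ u'"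
    using takeWhile_dropWhile_id[of Not w] by (simp add: u'_def)
  then have u_split: "u = True # zeros j @ u'" using v w_def by simp
  have hd: "hd u'" using \<open>u' \<noteq> []\<close> hd_dropWhile[of Not w] by (simp add: u'_def)
  have last: "last u'"
    using \<open>u' \<noteq> []\<close> w_split unfolding w_def by (metis last_appendR last_snoc)
  obtain x where x: "x \<in> Y" "occurs_in u x" and m: "ones u \<le> m"
    using u by (auto simp: G_def)
  from x(2) obtain i where i: "x [i \<rightarrow> i + length u] = u" by (auto simp: occurs_in_def)
  have "drop (Suc j) (x [i \<rightarrow> i + length u]) = u'"
    unfolding i by (simp add: u_split zeros_def)
  moreover have "i + length u = i + Suc j + length u'" by (simp add: u_split zeros_def)
  ultimately have "x [i + Suc j \<rightarrow> i + Suc j + length u'] = u'"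
    by (simp only: subsequence_drop)
  then have "occurs_in u' x" unfolding occurs_in_def by blast
  moreover have "ones u' \<le> m" using m by (simp add: u_split ones_def)
  ultimately have "u' \<in> G m Y"
    using x(1) \<open>u' \<noteq> []\<close> hd last by (auto simp: G_def from_1_to_1_iff)
  with u_split show thesis by (rule that(2))
qed (rule that(1))

lemma padded_word_nth:
  "((zeros \<alpha> @ u) \<frown> zero_word) t \<longleftrightarrow> \<alpha> \<le> t \<and> t - \<alpha> < length u \<and> u ! (t - \<alpha>)"
  by (auto simp: conc_def nth_append zeros_def zero_word_def)

lemma two_block_word_nth:
  "((zeros \<alpha> @ u @ zeros \<beta> @ v) \<frown> zero_word) t \<longleftrightarrow>
     \<alpha> \<le> t \<and> t - \<alpha> < length u \<and> u ! (t - \<alpha>) \<or>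
     \<alpha> + length u + \<beta> \<le> t \<and> t - (\<alpha> + length u + \<beta>) < length v \<and> v ! (t - (\<alpha> + length u + \<beta>))"
  by (auto simp: conc_def nth_append zeros_def zero_word_def)

lemma periodic_word_nth:
  assumes "u \<noteq> []"
  shows "(suffix l ((u @ zeros k)\<^sup>\<omega>)) t \<longleftrightarrow>
     (l + t) mod (length u + k) < length u \<and> u ! ((l + t) mod (length u + k))"
proof -
  define r where "r = (l + t) mod (length u + k)"
  have "r < length u + k" using assms by (simp add: r_def)
  then have "(u @ zeros k) ! r \<longleftrightarrow> r < length u \<and> u ! r"
    by (cases "r < length u") (simp_all add: nth_append zeros_def)
  then show ?thesis using assms by (simp add: r_def zeros_def)
qed

lemma P_stepE:
  assumes "y \<in> P_step m Y"
  obtains l u k where "y = suffix l ((u @ zeros k)\<^sup>\<omega>)" "u \<in> G (2 ^ m) Y" "k \<ge> 2 ^ (2 * m)"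
  using assms unfolding P_step_def shift_funpow by blast

lemma G_nonempty: "u \<in> G m Y \<Longrightarrow> u \<noteq> []"
  by (auto simp: G_def from_1_to_1_def)

text \<open>The gaps of length at least $2^{2m}$ prevent a short word from meeting two blocks.\<close>

lemma short_window_in_J1:
  assumes y: "y \<in> P_step m Y \<union> (J1_step m Y \<union> J2_step m Y)"
  obtains z t where "z \<in> J1_step m Y" "\<And>j. j < 2 ^ (2 * m) \<Longrightarrow> y (i + j) = z (t + j)"
proof -
  define K :: nat where "K = 2 ^ (2 * m)"
  from y consider "y \<in> P_step m Y" | "y \<in> J1_step m Y" | "y \<in> J2_step m Y" by blast
  then have "\<exists>z\<in>J1_step m Y. \<exists>t. \<forall>j<K. y (i + j) = z (t + j)"
  proof cases
    case 1
    then obtain l u k where yu: "y = suffix l ((u @ zeros k)\<^sup>\<omega>)" and u: "u \<in> G (2 ^ m) Y" and k: "k \<ge> K"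
      unfolding K_def by (rule P_stepE)
    have "u \<noteq> []" using u by (rule G_nonempty)
    define p where "p = length u + k"
    define r where "r = (l + i) mod p"
    have p: "p > 0" using \<open>u \<noteq> []\<close> by (simp add: p_def)
    have y_nth: "y (i + j) \<longleftrightarrow> (r + j) mod p < length u \<and> u ! ((r + j) mod p)" for j
    proof -
      have "(l + (i + j)) mod p = (r + j) mod p"
        unfolding r_def by (simp add: mod_add_left_eq add.assoc)
      then show ?thesis
        using periodic_word_nth[OF \<open>u \<noteq> []\<close>, of l k "i + j"] unfolding yu p_def by simp
    qed
    \<comment> \<open>The \<open>K\<close> leading zeros leave room for a window that starts up to
      \<open>K\<close> places before \<open>u\<close>.\<close>
    have z: "(zeros K @ u) \<frown> zero_word \<in> J1_step m Y"
      using u unfolding J1_step_def by blast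
    \<comment> \<open>A window starting inside a copy of \<open>u\<close> ends before the next copy,
      because the gap satisfies \<open>k \<ge> K\<close>.\<close>
    show ?thesis
    proof (cases "r < length u")
      case True
      then have "\<forall>j<K. y (i + j) = ((zeros K @ u) \<frown> zero_word) (K + r + j)"
        using k by (auto simp: y_nth padded_word_nth p_def)
      with z show ?thesis by blast
    next
      case False
      \<comment> \<open>The window starts in the gap, \<open>d\<close> places before the next copy
        of \<open>u\<close>. If \<open>d\<close> exceeds \<open>K\<close>, the truncated difference
        \<open>K - d\<close> is 0 and the window lies in the leading zeros.\<close>
      define d where "d = p - r"
      have r: "r < p" using p by (simp add: r_def)
      have "y (i + j) = ((zeros K @ u) \<frown> zero_word) (K - d + j)" if "j < K" for j
      proof (cases "j < d")
        case True
        then have "(r + j) mod p = r + j" using r by (simp add: d_def)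
        then show ?thesis using True False that by (auto simp: y_nth padded_word_nth)
      next
        case False
        then have "r + j = p + (j - d)" "j - d < p"
          using r that k by (auto simp: d_def p_def)
        then have "(r + j) mod p = j - d" by simp
        then show ?thesis using False that by (auto simp: y_nth padded_word_nth)
      qed
      with z show ?thesis by blast
    qed
  next
    case 2
    then show ?thesis by blast
  next
    case 3
    then obtain \<alpha> \<beta> u v where yu: "y = (zeros \<alpha> @ u @ zeros \<beta> @ v) \<frown> zero_word"
      and uv: "\<beta> \<ge> K" "u \<in> G (2 ^ m) Y" "v \<in> G (2 ^ m) Y"
      unfolding J2_step_def K_def by blast
    \<comment> \<open>Since \<open>\<beta> \<ge> K\<close>, a window that starts before the end of
      \<open>u\<close> cannot reach \<open>v\<close>; any other window meets at most
      \<open>v\<close>. Deleting the unseen block leaves a point of \<open>J1_step\<close>.\<close>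
    show ?thesis
    proof (cases "i < \<alpha> + length u")
      case True
      then have "\<forall>j<K. y (i + j) = ((zeros \<alpha> @ u) \<frown> zero_word) (i + j)"
        using uv(1) unfolding yu two_block_word_nth unfolding padded_word_nth by auto
      moreover have "(zeros \<alpha> @ u) \<frown> zero_word \<in> J1_step m Y"
        using uv unfolding J1_step_def by blast
      ultimately show ?thesis by blast
    next
      case False
      then have "\<forall>j<K. y (i + j) = ((zeros (\<alpha> + length u + \<beta>) @ v) \<frown> zero_word) (i + j)"
        unfolding yu two_block_word_nth unfolding padded_word_nth by auto
      moreover have "(zeros (\<alpha> + length u + \<beta>) @ v) \<frown> zero_word \<in> J1_step m Y"
        using uv unfolding J1_step_def by blast
      ultimately show ?thesis by blast
    qed
  qed
  then show thesis using that unfolding K_def by blast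
qed

text \<open>A word that begins and ends with 1 must lie inside the single block \<open>u\<close>,
  and \<open>u\<close> is taken from a point of \<open>Y\<close>.\<close>

lemma J1_prefix_occurs:
  assumes "prefix_occurs L x (J1_step m Y)" "L > 0" "x 0" "x (L - 1)"
  shows "prefix_occurs L x Y"
proof -
  from assms(1) obtain \<alpha> u t where u: "u \<in> G (2 ^ m) Y"
    and *: "\<And>j. j < L \<Longrightarrow> ((zeros \<alpha> @ u) \<frown> zero_word) (t + j) = x j"
    unfolding prefix_occurs_def J1_step_def by blast
  from *[of 0] *[of "L - 1"] assms(2-4)
  have t: "\<alpha> \<le> t" "t + (L - 1) - \<alpha> < length u" by (simp_all add: padded_word_nth)
  obtain z i where z: "z \<in> Y" "\<And>j. j < length u \<Longrightarrow> z (i + j) = u ! j"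
    using G_occurs[OF u] by blast
  have "z (i + (t - \<alpha>) + j) = x j" if "j < L" for j
  proof -
    have "t - \<alpha> + j < length u" using t that by linarith
    then show ?thesis
      using *[OF that] z(2)[of "t - \<alpha> + j"] t(1) by (simp add: padded_word_nth add.assoc)
  qed
  then show ?thesis unfolding prefix_occurs_def using z(1) by blast
qed

section \<open>Bounds on the number of ones in a window\<close>

lemma ones_before_block:
  assumes "\<And>j. j < n \<Longrightarrow> x (t + j) \<Longrightarrow> s \<le> t + j \<and> t + j - s < length u \<and> u ! (t + j - s)"
  shows "ones_before n (suffix t x) \<le> ones u"
  unfolding ones_eq_card
proof (rule card_inj_on_le)
  show "inj_on (\<lambda>j. t + j - s) {j. j < n \<and> suffix t x j}"
    using assms by (auto simp: inj_on_def) (metis add_left_cancel eq_diff_iff)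
  show "(\<lambda>j. t + j - s) ` {j. j < n \<and> suffix t x j} \<subseteq> {i. i < length u \<and> u ! i}"
    using assms by auto
qed auto

lemma J1_ones_le:
  assumes "z \<in> J1_step m Y"
  shows "ones_before n (suffix t z) \<le> 2 ^ m"
proof -
  from assms obtain \<alpha> u where "z = (zeros \<alpha> @ u) \<frown> zero_word" and u: "ones u \<le> 2 ^ m"
    unfolding J1_step_def G_def by blast
  then have "ones_before n (suffix t z) \<le> ones u"
    by (intro ones_before_block[where s = \<alpha>]) (simp add: padded_word_nth)
  with u show ?thesis by simp
qed

lemma J2_ones_le:
  assumes "z \<in> J2_step m Y"
  shows "ones_before n (suffix t z) \<le> 2 * 2 ^ m"
proof -
  from assms obtain \<alpha> \<beta> u v where z: "z = (zeros \<alpha> @ u @ zeros \<beta> @ v) \<frown> zero_word"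
    and uv: "ones u \<le> 2 ^ m" "ones v \<le> 2 ^ m"
    unfolding J2_step_def G_def by blast
  let ?a = "(zeros \<alpha> @ u) \<frown> zero_word" and ?b = "(zeros (\<alpha> + length u + \<beta>) @ v) \<frown> zero_word"
  have "ones_before n (suffix t z)
      \<le> card ({j. j < n \<and> suffix t ?a j} \<union> {j. j < n \<and> suffix t ?b j})"
    unfolding z suffix_nth two_block_word_nth unfolding padded_word_nth by (intro card_mono) auto
  also have "\<dots> \<le> ones_before n (suffix t ?a) + ones_before n (suffix t ?b)"
    by (rule card_Un_le)
  also have "\<dots> \<le> ones u + ones v"
    by (intro add_mono ones_before_block[where s = \<alpha>] ones_before_block[where s = "\<alpha> + length u + \<beta>"])
      (simp_all add: padded_word_nth)
  finally show ?thesis using uv by simp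
qed

text \<open>At most \<open>length u + k\<close> consecutive places have distinct residues modulo the
  period, so each 1 of \<open>u\<close> is seen at most once.\<close>

lemma periodic_ones_le:
  assumes "u \<noteq> []" "n \<le> length u + k"
  shows "ones_before n (suffix t ((u @ zeros k)\<^sup>\<omega>)) \<le> ones u"
  unfolding ones_eq_card
proof (rule card_inj_on_le)
  let ?p = "length u + k"
  show "inj_on (\<lambda>j. (t + j) mod ?p) {j. j < n \<and> suffix t ((u @ zeros k)\<^sup>\<omega>) j}"
  proof (rule linorder_inj_onI)
    fix i j assume *: "i < j" "j \<in> {j. j < n \<and> suffix t ((u @ zeros k)\<^sup>\<omega>) j}"
    show "(t + i) mod ?p \<noteq> (t + j) mod ?p"
    proof
      assume "(t + i) mod ?p = (t + j) mod ?p"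
      then have "?p dvd t + j - (t + i)"
        using * mod_eq_dvd_iff_nat[of "t + i" "t + j" ?p] by auto
      then show False using * assms(2) by (auto dest!: dvd_imp_le)
    qed
  qed auto
  show "(\<lambda>j. (t + j) mod ?p) ` {j. j < n \<and> suffix t ((u @ zeros k)\<^sup>\<omega>) j} \<subseteq> {i. i < length u \<and> u ! i}"
    using periodic_word_nth[OF assms(1), of t k] by (auto simp del: suffix_nth)
qed auto

section \<open>First occurrence of a prefix in the sequence of sets\<close>

lemma X_seq_mono: "m \<le> n \<Longrightarrow> X_seq m \<subseteq> X_seq n"
  by (rule lift_Suc_mono_le[of X_seq]) auto

lemma X_seq_Suc: "X_seq (Suc n) = X_seq n \<union> closure (step_points n)"
  by (simp add: Y_step_def step_points_def)

lemma prefix_occurs_X_seq_Suc: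
  "prefix_occurs L x (X_seq (Suc n)) \<Longrightarrow> prefix_occurs L x (X_seq n) \<or> prefix_occurs L x (step_points n)"
  using prefix_occurs_closure[of L x "step_points n"]
  unfolding X_seq_Suc prefix_occurs_def by blast

text \<open>Unfolding the recursion and discarding each closure reduces occurrence in $X_n$ to
  occurrence in $X_0$ or in explicitly given points.\<close>

lemma prefix_occurs_X_seqD:
  "prefix_occurs L x (X_seq n) \<Longrightarrow>
     prefix_occurs L x (X_seq 0) \<or> (\<exists>m<n. prefix_occurs L x (step_points m))"
proof (induction n)
  case (Suc n)
  then show ?case using prefix_occurs_X_seq_Suc[OF Suc.prems] less_Suc_eq by blast
qed simp

lemma X_seq_0_ones_le:
  assumes "z \<in> X_seq 0"
  shows "ones_before n (suffix t z) \<le> 1"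
proof -
  have "ones_before n (suffix t z) \<le> ones [True]"
  proof (cases "z = zero_word")
    case False
    then obtain \<alpha> where "z = (zeros \<alpha> @ [True]) \<frown> zero_word" using assms by auto
    then show ?thesis by (intro ones_before_block[where s = \<alpha>]) (simp only: padded_word_nth)
  qed (simp add: zero_word_def)
  then show ?thesis by (simp add: ones_def)
qed

lemma prefix_occurs_onesE:
  assumes "prefix_occurs n x S"
  obtains z t where "z \<in> S" "\<And>j. j < n \<Longrightarrow> z (t + j) = x j" "ones_before n x = ones_before n (suffix t z)"
proof -
  from assms obtain z t where z: "z \<in> S" "\<And>j. j < n \<Longrightarrow> z (t + j) = x j"
    unfolding prefix_occurs_def by blast
  then have "ones_before n x = ones_before n (suffix t z)"
    by (intro ones_before_cong) simp
  with z show thesis by (rule that)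
qed

text \<open>The sparsity estimate for a prefix that first appears after $X_{m_0}$: its density of
  ones is at most \<open>2 / 2 ^ m0\<close>, multiplied out to stay within the natural numbers. The
  ones at both ends allow \<open>J1_prefix_occurs\<close> to exclude prefixes shorter than
  \<open>K\<close>.\<close>

lemma ones_before_new_word:
  assumes x: "x 0" "x (N - 1)" "N > 0"
    and occ: "prefix_occurs N x (\<Union>n. X_seq n)" and nocc: "\<not> prefix_occurs N x (X_seq m0)"
  shows "2 ^ m0 * ones_before N x \<le> 2 * N"
proof -
  define k where "k = (LEAST k. prefix_occurs N x (X_seq k))"
  have "\<exists>k. prefix_occurs N x (X_seq k)"
    using occ unfolding prefix_occurs_def by blast
  then have k: "prefix_occurs N x (X_seq k)" and k_min: "\<And>m. m < k \<Longrightarrow> \<not> prefix_occurs N x (X_seq m)"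
    unfolding k_def by (auto intro: LeastI_ex dest: not_less_Least)
  have "m0 < k"
  proof (rule ccontr)
    assume "\<not> m0 < k"
    then show False
      using nocc prefix_occurs_mono[OF k order_refl X_seq_mono[of k m0]] by simp
  qed
  then obtain m where m: "k = Suc m" "m0 \<le> m" by (cases k) auto
  have new: "\<not> prefix_occurs N x (X_seq m)" using k_min m by simp
  then have "prefix_occurs N x (step_points m)"
    using prefix_occurs_X_seq_Suc k m by blast
  then obtain y i where y: "y \<in> step_points m" "\<And>j. j < N \<Longrightarrow> y (i + j) = x j"
      and ones: "ones_before N x = ones_before N (suffix i y)"
    by (rule prefix_occurs_onesE) blast
  define K :: nat where "K = 2 ^ (2 * m)"
  have "K > 0" by (simp add: K_def)
  have K: "K = 2 ^ m * 2 ^ m" by (simp add: K_def mult_2 power_add)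
  have "K \<le> N"
  proof (rule ccontr)
    assume "\<not> K \<le> N"
    obtain z t where "z \<in> J1_step m (X_seq m)" "\<And>j. j < K \<Longrightarrow> y (i + j) = z (t + j)"
      using short_window_in_J1[OF y(1)[unfolded step_points_def]] unfolding K_def by metis
    then have "prefix_occurs N x (J1_step m (X_seq m))"
      unfolding prefix_occurs_def using y(2) \<open>\<not> K \<le> N\<close>
      by (metis less_trans linorder_not_le)
    then show False using J1_prefix_occurs x new by blast
  qed
  have "ones_before K (suffix s (suffix i y)) \<le> 2 ^ m" for s
  proof -
    obtain z t where z: "z \<in> J1_step m (X_seq m)" "\<And>j. j < K \<Longrightarrow> y (i + s + j) = z (t + j)"
      using short_window_in_J1[OF y(1)[unfolded step_points_def], of "i + s"] unfolding K_def by metis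
    have "ones_before K (suffix s (suffix i y)) = ones_before K (suffix t z)"
      using z(2) by (intro ones_before_cong) (simp add: add.assoc)
    then show ?thesis using J1_ones_le[OF z(1), of K t] by simp
  qed
  then have "ones_before N x \<le> 2 ^ m * (N div K + 1)"
    unfolding ones using \<open>K > 0\<close> by (rule ones_before_le_windows)
  then have "2 ^ m * ones_before N x \<le> K * (N div K + 1)"
    unfolding K by (metis mult.assoc mult_le_mono2)
  also have "\<dots> = K * (N div K) + K" by simp
  \<comment> \<open>The second summand pays for the incomplete last window, which
    \<open>K \<le> N\<close> makes affordable.\<close>
  also have "\<dots> \<le> N + N" using \<open>K \<le> N\<close> by (intro add_mono) auto
  finally have "2 ^ m * ones_before N x \<le> 2 * N" by simp
  moreover have "(2 :: nat) ^ m0 * ones_before N x \<le> 2 ^ m * ones_before N x"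
    using m(2) by (intro mult_right_mono power_increasing) auto
  ultimately show ?thesis by linarith
qed

section \<open>Points with infinitely many ones\<close>

lemma infinite_ones_before:
  assumes "infinite {j. x j}"
  obtains n where "ones_before n x > c"
proof -
  obtain A where A: "A \<subseteq> {j. x j}" "finite A" "card A = Suc c"
    using infinite_arbitrarily_large[OF assms] by blast
  obtain n where "A \<subseteq> {..<n}" using finite_nat_bounded[OF A(2)] by blast
  then have "card A \<le> ones_before n x"
    using A(1) by (intro card_mono) auto
  then show thesis using A(3) by (intro that[of n]) simp
qed

text \<open>Points of $X_0$, and of $J'$ and $J''$ in steps below \<open>n\<close>, have at most
  \<open>2 * 2 ^ n\<close> ones, so a prefix with more ones comes from a periodic word. That word
  may change with the length of the prefix, hence the search for one period common to all
  candidates.\<close>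

lemma periodic_if_prefixes_occur:
  assumes inf: "infinite {j. x j}" and occ: "\<And>N. prefix_occurs N x (X_seq n)"
  obtains p where "p \<ge> 1" "suffix p x = x"
proof -
  obtain N0 where N0: "ones_before N0 x > 2 * 2 ^ n"
    using infinite_ones_before[OF inf] .
  \<comment> \<open>A prefix with this many ones spans more than one period of any periodic word of a step below \<open>n\<close>,
    so all these periods are less than \<open>N0\<close> and \<open>fact N0\<close> is a common multiple.\<close>
  have "x (fact N0 + i) = x i" for i
  proof -
    \<comment> \<open>Long enough to cover the first \<open>N0\<close> symbols and both compared
      places \<open>i\<close> and \<open>fact N0 + i\<close>.\<close>
    define N where "N = N0 + fact N0 + i + 1"
    have N: "ones_before N x > 2 * 2 ^ n"
      using N0 ones_before_mono[of N0 N x] by (simp add: N_def)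
    have "\<not> prefix_occurs N x (X_seq 0)"
    proof
      assume "prefix_occurs N x (X_seq 0)"
      then obtain z t where "z \<in> X_seq 0" "ones_before N x = ones_before N (suffix t z)"
        by (rule prefix_occurs_onesE) blast
      moreover have "(2 :: nat) ^ n > 0" by simp
      ultimately show False using X_seq_0_ones_le[of z N t] N by linarith
    qed
    then obtain m where "m < n" and occ_m: "prefix_occurs N x (step_points m)"
      using prefix_occurs_X_seqD[OF occ] by blast
    from occ_m obtain z t where z: "z \<in> step_points m" "\<And>j. j < N \<Longrightarrow> z (t + j) = x j"
        and ones: "ones_before N x = ones_before N (suffix t z)"
      by (rule prefix_occurs_onesE) blast
    have pow: "(2 :: nat) ^ m \<le> 2 ^ n" using \<open>m < n\<close> by (intro power_increasing) auto
    have "z \<notin> J1_step m (X_seq m)"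
      using N pow ones J1_ones_le[of z m "X_seq m" N t] by linarith
    moreover have "z \<notin> J2_step m (X_seq m)"
      using N pow ones J2_ones_le[of z m "X_seq m" N t] by linarith
    ultimately have "z \<in> P_step m (X_seq m)" using z(1) by (auto simp: step_points_def)
    then obtain l u k where zu: "z = suffix l ((u @ zeros k)\<^sup>\<omega>)" and u: "u \<in> G (2 ^ m) (X_seq m)"
      by (rule P_stepE)
    have "u \<noteq> []" using u by (rule G_nonempty)
    have "ones u \<le> 2 ^ m" using u by (simp add: G_def)
    have "length u + k < N0"
    proof (rule ccontr)
      assume "\<not> length u + k < N0"
      then have "ones_before N0 (suffix (l + t) ((u @ zeros k)\<^sup>\<omega>)) \<le> ones u"
        using \<open>u \<noteq> []\<close> by (intro periodic_ones_le) auto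
      moreover have "ones_before N0 x = ones_before N0 (suffix (l + t) ((u @ zeros k)\<^sup>\<omega>))"
        using z(2) by (intro ones_before_cong) (simp add: zu N_def add.assoc)
      ultimately show False using N0 \<open>ones u \<le> 2 ^ m\<close> pow by linarith
    qed
    then have "(length u + k) dvd fact N0"
      using \<open>u \<noteq> []\<close> by (intro dvd_fact) (auto simp: Suc_le_eq)
    then obtain q where q: "fact N0 = (length u + k) * q" by blast
    have "(l + (t + (fact N0 + i))) mod (length u + k) = (l + (t + i)) mod (length u + k)"
    proof -
      have "l + (t + (fact N0 + i)) = l + (t + i) + (length u + k) * q" using q by simp
      then show ?thesis by (metis mod_mult_self2)
    qed
    then have "z (t + (fact N0 + i)) = z (t + i)"
      unfolding zu periodic_word_nth[OF \<open>u \<noteq> []\<close>] by simp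
    then show ?thesis using z(2)[of "fact N0 + i"] z(2)[of i] by (simp add: N_def)
  qed
  then have "suffix (fact N0) x = x" by (simp add: fun_eq_iff)
  then show thesis by (intro that[of "fact N0"]) (simp_all add: Suc_le_eq)
qed

text \<open>For each \<open>m\<close>, all sufficiently long prefixes are new after $X_m$, and
  \<open>ones_before_new_word\<close> bounds their density of ones by
  \<open>2 / 2 ^ m\<close>.\<close>

lemma sparse_if_new_prefixes:
  assumes inf: "infinite {j. x j}" and x0: "x 0"
    and occ: "\<And>N. prefix_occurs N x (\<Union>n. X_seq n)"
    and nocc: "\<And>n. \<exists>N. \<not> prefix_occurs N x (X_seq n)"
  shows "sparse x"
  unfolding sparse_def
proof (rule LIMSEQ_I)
  fix e :: real assume "e > 0"
  obtain m where "(1 / 2) ^ m < e / 2"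
    using real_arch_pow_inv[of "e / 2" "1 / 2"] \<open>e > 0\<close> by auto
  then have m: "2 / 2 ^ m < e" by (simp add: power_one_over)
  obtain N0 where N0: "\<not> prefix_occurs N0 x (X_seq m)" using nocc by blast
  \<comment> \<open>A 1 at or beyond \<open>N0\<close> ensures that a prefix cut after its last 1
    still has length at least \<open>N0\<close>.\<close>
  obtain M where M: "x M" "M \<ge> N0"
    using inf unfolding infinite_nat_iff_unbounded_le by auto
  show "\<exists>no. \<forall>n\<ge>no. norm (real (ones_before n x) / real n - 0) < e"
  proof (intro exI[of _ "Suc M"] allI impI)
    fix n assume n: "Suc M \<le> n"
    \<comment> \<open>Cutting the prefix right after its last 1 keeps all its ones and yields a word
      ending with 1, as the estimate requires.\<close>
    define N where "N = Suc (Max {j. j < n \<and> x j})"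
    have "M \<in> {j. j < n \<and> x j}" using n M by simp
    then have Max: "Max {j. j < n \<and> x j} \<in> {j. j < n \<and> x j}" "M \<le> Max {j. j < n \<and> x j}"
      by (intro Max_in Max_ge; force)+
    then have N: "N \<le> n" "x (N - 1)" "N0 \<le> N" "N > 0" using M(2) by (auto simp: N_def)
    have "{j. j < n \<and> x j} = {j. j < N \<and> x j}"
      using N(1) Max_ge[of "{j. j < n \<and> x j}"] by (auto simp: N_def less_Suc_eq_le)
    moreover have "\<not> prefix_occurs N x (X_seq m)"
      using N0 N(3) prefix_occurs_mono by blast
    ultimately have "2 ^ m * ones_before n x \<le> 2 * N"
      using ones_before_new_word[OF x0 N(2,4) occ] by metis
    then have "2 ^ m * ones_before n x \<le> 2 * n" using N(1) by simp
    then have "real (2 ^ m * ones_before n x) \<le> real (2 * n)" by (rule of_nat_mono)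
    then have "real (ones_before n x) / real n \<le> 2 / 2 ^ m"
      using n by (simp add: field_simps)
    then show "norm (real (ones_before n x) / real n - 0) < e" using m by simp
  qed
qed

text \<open>Periodicity can fail before the first 1: if $y$ is a periodic point of some $X_n$ with $y_0 = 1$
  and $v$ is a prefix of $y$ ending with 1, then $0^a v 0^\infty$ lies in the later sets $J'$, so $X$
  contains $0^a y$.\<close>

lemma X_lim_dichotomy:
  assumes "x \<in> X_lim"
  obtains a p where "p \<ge> 1" "suffix p (suffix a x) = suffix a x" | "sparse x"
proof (cases "finite {j. x j}")
  case True
  then show thesis using sparse_finite that(2) by blast
next
  case False
  \<comment> \<open>Dropping the symbols before a 1 gives a point that starts with 1; both
    conclusions pass back to \<open>x\<close>.\<close>
  then obtain a where a: "x a" using not_finite_existsD by auto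
  let ?x = "suffix a x"
  have inf: "infinite {j. ?x j}"
  proof
    assume "finite {j. ?x j}"
    moreover have "{j. x j} \<subseteq> {..<a} \<union> (\<lambda>j. a + j) ` {j. ?x j}"
      by (auto simp: image_iff) (metis le_add_diff_inverse linorder_not_less)
    ultimately show False using False finite_subset by (metis finite_UnI finite_imageI finite_lessThan)
  qed
  have "prefix_occurs N ?x X_lim" for N
    unfolding prefix_occurs_def using assms by (intro bexI[of _ x] exI[of _ a]) auto
  then have occ: "prefix_occurs N ?x (\<Union>n. X_seq n)" for N
    unfolding X_lim_def by (rule prefix_occurs_closure)
  show thesis
  proof (cases "\<exists>n. \<forall>N. prefix_occurs N ?x (X_seq n)")
    case True
    then show thesis using periodic_if_prefixes_occur[OF inf] that(1) by metis
  next
    case False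
    then have "sparse ?x"
      using inf a occ by (intro sparse_if_new_prefixes) auto
    then show thesis using sparse_suffixD that(2) by blast
  qed
qed

subsection \<open>Shift invariance\<close>

text \<open>Merging the nested closures into one leaves shift invariance to be checked only for
  explicit points.\<close>

lemma X_lim_eq: "X_lim = closure (X_seq 0 \<union> (\<Union>m. step_points m))"
proof
  let ?C = "closure (X_seq 0 \<union> (\<Union>m. step_points m))"
  have "X_seq n \<subseteq> ?C" for n
  proof (induction n)
    case 0
    show ?case by (meson Un_upper1 closure_subset subset_trans)
  next
    case (Suc n)
    have "closure (step_points n) \<subseteq> ?C" by (intro closure_mono) auto
    with Suc show ?case unfolding X_seq_Suc by blast
  qed
  then show "X_lim \<subseteq> ?C"
    unfolding X_lim_def by (intro closure_minimal) auto
  have "step_points m \<subseteq> X_seq (Suc m)" for m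
    using closure_subset[of "step_points m"] unfolding X_seq_Suc by blast
  then show "?C \<subseteq> X_lim"
    unfolding X_lim_def by (intro closure_mono) blast
qed

lemma shift_padded: "shift ((zeros (Suc \<alpha>) @ u) \<frown> w) = (zeros \<alpha> @ u) \<frown> w"
  by (auto simp: fun_eq_iff conc_def zeros_def)

lemma shift_Cons: "shift ((b # u) \<frown> w) = u \<frown> w"
  by (auto simp: fun_eq_iff conc_def)

text \<open>The set $P$ is closed under the shift by construction. A point of $J'$ or $J''$ loses a
  leading zero or the first 1 of its first block. If that block is the single 1, a point of $J''$
  becomes one of $J'$, and a point of $J'$ becomes \<open>zero_word\<close>, which is why
  \<open>X_seq 0\<close> appears in the conclusion.\<close>

lemma shift_step_points:
  assumes "y \<in> step_points m"
  shows "shift y \<in> X_seq 0 \<union> step_points m"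
proof -
  let ?Y = "X_seq m"
  from assms consider "y \<in> P_step m ?Y" | "y \<in> J1_step m ?Y" | "y \<in> J2_step m ?Y"
    unfolding step_points_def by blast
  then show ?thesis
  proof cases
    case 1
    then obtain l u k where *: "y = suffix l ((u @ zeros k)\<^sup>\<omega>)" "u \<in> G (2 ^ m) ?Y" "k \<ge> 2 ^ (2 * m)"
      by (rule P_stepE)
    have "shift y = (shift ^^ (l + 1)) ((u @ zeros k)\<^sup>\<omega>)"
      unfolding shift_funpow * by simp
    then have "shift y \<in> P_step m ?Y" unfolding P_step_def using * by blast
    then show ?thesis by (simp add: step_points_def)
  next
    case 2
    then obtain \<alpha> u where y: "y = (zeros \<alpha> @ u) \<frown> zero_word" and u: "u \<in> G (2 ^ m) ?Y"
      unfolding J1_step_def by blast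
    show ?thesis
    proof (cases \<alpha>)
      case 0
      from u show ?thesis
      proof (cases rule: G_tail)
        case 1
        then have "shift y = zero_word" using y 0 by (simp only: zeros_def replicate_0 append_Nil shift_Cons conc_empty)
        then show ?thesis by simp
      next
        case (2 j u')
        then have "shift y = (zeros j @ u') \<frown> zero_word"
          using y 0 by (simp only: zeros_def replicate_0 append_Nil shift_Cons)
        then show ?thesis using 2(2) unfolding step_points_def J1_step_def by blast
      qed
    next
      case (Suc \<alpha>')
      then have "shift y = (zeros \<alpha>' @ u) \<frown> zero_word" using y by (simp only: shift_padded)
      then show ?thesis using u unfolding step_points_def J1_step_def by blast
    qed
  next
    case 3
    then obtain \<alpha> \<beta> u v where y: "y = (zeros \<alpha> @ u @ zeros \<beta> @ v) \<frown> zero_word"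
      and uv: "\<beta> \<ge> 2 ^ (2 * m)" "u \<in> G (2 ^ m) ?Y" "v \<in> G (2 ^ m) ?Y"
      unfolding J2_step_def by blast
    show ?thesis
    proof (cases \<alpha>)
      case 0
      from uv(2) show ?thesis
      proof (cases rule: G_tail)
        case 1
        then have "shift y = (zeros \<beta> @ v) \<frown> zero_word"
          using y 0 by (simp only: zeros_def replicate_0 append_Nil append_Cons shift_Cons)
        then show ?thesis using uv unfolding step_points_def J1_step_def by blast
      next
        case (2 j u')
        then have "shift y = (zeros j @ u' @ zeros \<beta> @ v) \<frown> zero_word"
          using y 0 by (simp only: zeros_def replicate_0 append_Nil append_Cons append_assoc shift_Cons)
        then show ?thesis using 2(2) uv unfolding step_points_def J2_step_def by blast
      qed
    next
      case (Suc \<alpha>')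
      then have "shift y = (zeros \<alpha>' @ u @ zeros \<beta> @ v) \<frown> zero_word" using y by (simp only: shift_padded)
      then show ?thesis using uv unfolding step_points_def J2_step_def by blast
    qed
  qed
qed

lemma shift_X_seq_0: "y \<in> X_seq 0 \<Longrightarrow> shift y \<in> X_seq 0"
proof -
  assume "y \<in> X_seq 0"
  then consider "y = zero_word" | \<alpha> where "y = (zeros \<alpha> @ [True]) \<frown> zero_word" by auto
  then show ?thesis
  proof cases
    case 1
    then have "shift y = zero_word" by (simp add: zero_word_def fun_eq_iff)
    then show ?thesis by simp
  next
    case (2 \<alpha>)
    show ?thesis
    proof (cases \<alpha>)
      case 0
      then have "shift y = zero_word"
        using 2 by (simp only: zeros_def replicate_0 append_Nil shift_Cons conc_empty)
      then show ?thesis by simp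
    next
      case (Suc \<alpha>')
      then have "shift y = (zeros \<alpha>' @ [True]) \<frown> zero_word" using 2 by (simp only: shift_padded)
      then show ?thesis unfolding X_seq.simps by blast
    qed
  qed
qed

text \<open>Invariance of the explicit points passes to the closure by continuity of the
  shift.\<close>

lemma shift_X_lim: "y \<in> X_lim \<Longrightarrow> shift y \<in> X_lim"
proof -
  let ?U = "X_seq 0 \<union> (\<Union>m. step_points m)"
  have "shift ` ?U \<subseteq> ?U" using shift_step_points shift_X_seq_0 by blast
  then have "shift ` closure ?U \<subseteq> closure ?U"
    by (intro image_closure_subset[OF continuous_on_suffix closed_closure] subset_trans[OF _ closure_subset])
  then show "y \<in> X_lim \<Longrightarrow> shift y \<in> X_lim" unfolding X_lim_eq by blast
qed

lemma zero_word_in_X_lim: "zero_word \<in> X_lim"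
proof -
  have "zero_word \<in> X_seq 0 \<union> (\<Union>m. step_points m)" by simp
  then show ?thesis unfolding X_lim_eq by (rule subsetD[OF closure_subset])
qed

subsection \<open>Generic points and ergodic measures\<close>

lemma suffix_X_lim: "x \<in> X_lim \<Longrightarrow> suffix j x \<in> X_lim"
proof (induction j)
  case (Suc j)
  then show ?case using shift_X_lim[of "suffix j x"] by (simp del: suffix_nth)
qed simp

lemma compact_X_lim: "compact X_lim"
  using compact_Int_closed[OF compact_UNIV_word, of X_lim] by (simp add: X_lim_def)

lemma X_lim_generic:
  assumes x: "x \<in> X_lim"
  shows "\<exists>M. ergodic_prob_on X_lim M \<and> generic_for X_lim x M"
  using x
proof (cases rule: X_lim_dichotomy)
  case (1 a p)
  let ?q = "suffix a x"
  have "(\<lambda>n. (\<Sum>j<n. f ((shift ^^ j) x)) / real n) \<longlonglongrightarrow> integral\<^sup>L (orbit_measure X_lim p ?q) f"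
    if f: "continuous_on X_lim f" for f :: "bool word \<Rightarrow> real"
  proof -
    have "suffix (j + p) x = suffix j x" if "j \<ge> a" for j
    proof -
      have "suffix (j + p) x = suffix (j - a) (suffix p (suffix a x))"
        using that by (simp add: add_ac del: suffix_nth)
      then show ?thesis unfolding 1(2) using that by (simp del: suffix_nth)
    qed
    then have "(\<lambda>n. (\<Sum>j<n. f (suffix j x)) / real n) \<longlonglongrightarrow> (\<Sum>j<p. f (suffix (a + j) x)) / real p"
      using 1(1) by (intro Cesaro_mean_periodic) auto
    moreover have "integral\<^sup>L (orbit_measure X_lim p ?q) f = (\<Sum>j<p. f (suffix j ?q)) / real p"
      using 1(1) suffix_X_lim[OF suffix_X_lim[OF x]] f by (rule integral_orbit_measure)
    ultimately show ?thesis unfolding shift_funpow by simp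
  qed
  moreover have "ergodic_prob_on X_lim (orbit_measure X_lim p ?q)"
    using 1 shift_X_lim suffix_X_lim[OF x] by (rule ergodic_orbit_measure)
  ultimately show ?thesis unfolding generic_for_def using x by blast
next
  case 2
  have zero: "suffix j zero_word = zero_word" for j
    by (simp add: fun_eq_iff zero_word_def)
  \<comment> \<open>With period 1 the orbit measure is the point mass at the fixed point
    \<open>zero_word\<close>.\<close>
  have "(\<lambda>n. (\<Sum>j<n. f ((shift ^^ j) x)) / real n) \<longlonglongrightarrow> integral\<^sup>L (orbit_measure X_lim 1 zero_word) f"
    if f: "continuous_on X_lim f" for f :: "bool word \<Rightarrow> real"
    using sparse_orbit_mean[OF compact_X_lim zero_word_in_X_lim suffix_X_lim[OF x] f 2]
      integral_orbit_measure[OF order_refl suffix_X_lim[OF zero_word_in_X_lim] f]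
    unfolding shift_funpow by simp
  moreover have "ergodic_prob_on X_lim (orbit_measure X_lim 1 zero_word)"
    using order_refl zero shift_X_lim zero_word_in_X_lim by (rule ergodic_orbit_measure)
  ultimately show ?thesis unfolding generic_for_def using x by blast
qed

section \<open>Ergodic measures\<close>

lemma invariant_prob_onD:
  assumes "invariant_prob_on S M"
  shows "space M = S" "prob_space M"
    and "A \<in> sets borel \<Longrightarrow> A \<subseteq> S \<Longrightarrow> A \<in> sets M"
    and "suffix k \<in> measurable M M"
    and "A \<in> sets M \<Longrightarrow> measure M (suffix k -` A \<inter> S) = measure M A"
proof -
  show space: "space M = S" and "prob_space M"
    using assms by (auto simp: invariant_prob_on_def)
  have sets: "sets M = sets (restrict_space borel S)" and shift: "shift \<in> measurable M M"
    and distr: "distr M M shift = M"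
    using assms by (auto simp: invariant_prob_on_def simp del: One_nat_def)
  show "A \<in> sets M" if "A \<in> sets borel" "A \<subseteq> S"
    unfolding sets sets_restrict_space using that by (auto simp: image_iff intro!: bexI[of _ A])
  have suffix_Suc: "suffix (Suc k) = shift \<circ> suffix k" for k :: nat
    by (simp add: fun_eq_iff)
  have *: "suffix k \<in> measurable M M \<and> distr M M (suffix k) = M" for k
  proof (induction k)
    case 0
    have "suffix 0 = (\<lambda>x :: bool word. x)" by (simp add: fun_eq_iff)
    then show ?case by (simp only: distr_id measurable_ident_sets)
  next
    case (Suc k)
    then have "distr M M (suffix (Suc k)) = distr (distr M M (suffix k)) M shift"
      unfolding suffix_Suc by (intro distr_distr[symmetric] shift) blast
    moreover have "shift \<circ> suffix k \<in> measurable M M"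
      using Suc shift by (blast intro: measurable_comp)
    ultimately show ?case unfolding suffix_Suc using Suc distr by metis
  qed
  then show "suffix k \<in> measurable M M" by blast
  show "measure M (suffix k -` A \<inter> S) = measure M A" if "A \<in> sets M"
    using measure_distr[of "suffix k" M M A] * that space by simp
qed

text \<open>The orbit is only forward invariant, whereas ergodicity concerns sets equal to their
  preimage. The set of points that eventually enter the orbit is such a set. It is an increasing
  union of preimages of the orbit, all of the same measure, so it has the measure of the orbit,
  which is positive because of the atom.\<close>

lemma ergodic_atom_orbit:
  assumes M: "ergodic_prob_on S M" and p: "\<And>j. suffix j p \<in> S" and pos: "measure M {p} > 0"
  shows "measure M (orbit_of p) = 1"
proof -
  have inv: "invariant_prob_on S M" using M by (simp add: ergodic_prob_on_def)
  note inv' = invariant_prob_onD[OF inv]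
  interpret prob_space M by (rule inv'(2))
  let ?O = "orbit_of p"
  have orbit: "?O = (\<Union>j. {suffix j p})" unfolding orbit_of_def shift_funpow by auto
  have "closed {y}" for y :: "bool word" by (rule closed_singleton_word)
  then have "?O \<in> sets borel" unfolding orbit by (intro sets.countable_UN) auto
  moreover have "?O \<subseteq> S" using p unfolding orbit by blast
  ultimately have O: "?O \<in> sets M" by (rule inv'(3))
  define A where "A n = suffix n -` ?O \<inter> S" for n
  have A: "A n \<in> sets M" for n
    using measurable_sets[OF inv'(4) O] unfolding A_def inv'(1) .
  have O_shift: "shift y \<in> ?O" if "y \<in> ?O" for y
  proof -
    from that obtain j where "y = suffix j p" unfolding orbit by blast
    then have "shift y = suffix (Suc j) p" by simp
    then show ?thesis unfolding orbit by blast
  qed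
  have "incseq A"
  proof (rule incseq_SucI, rule subsetI)
    fix n y assume "y \<in> A n"
    moreover have "suffix (Suc n) y = shift (suffix n y)" by simp
    ultimately show "y \<in> A (Suc n)" using O_shift by (simp only: A_def Int_iff vimage_eq)
  qed
  have S_shift: "shift y \<in> S" if "y \<in> S" for y
    using measurable_space[OF inv'(4)[of 1]] that inv'(1) by auto
  have "shift -` (\<Union>n. A n) \<inter> space M = (\<Union>n. A n)"
  proof (intro equalityI subsetI)
    fix y assume "y \<in> shift -` (\<Union>n. A n) \<inter> space M"
    then obtain n where n: "suffix n (shift y) \<in> ?O" "y \<in> S" unfolding A_def inv'(1) by blast
    moreover have "suffix n (shift y) = suffix (Suc n) y" by simp
    ultimately have "y \<in> A (Suc n)" by (simp only: A_def Int_iff vimage_eq)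
    then show "y \<in> (\<Union>n. A n)" by blast
  next
    fix y assume "y \<in> (\<Union>n. A n)"
    then obtain n where n: "suffix n y \<in> ?O" "y \<in> S" unfolding A_def by blast
    have "shift (suffix n y) = suffix n (shift y)" by simp
    then have "shift y \<in> A n" using O_shift[OF n(1)] S_shift[OF n(2)]
      by (simp only: A_def Int_iff vimage_eq)
    then show "y \<in> shift -` (\<Union>n. A n) \<inter> space M" using n(2) unfolding inv'(1) by blast
  qed
  moreover have "(\<Union>n. A n) \<in> sets M" using A by blast
  ultimately have "measure M (\<Union>n. A n) = 0 \<or> measure M (\<Union>n. A n) = 1"
    using M unfolding ergodic_prob_on_def by blast
  moreover have "measure M (\<Union>n. A n) = measure M ?O"
  proof (rule LIMSEQ_unique)
    show "(\<lambda>n. measure M (A n)) \<longlonglongrightarrow> measure M (\<Union>n. A n)"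
      using A \<open>incseq A\<close> by (intro finite_Lim_measure_incseq) auto
    have "measure M (A n) = measure M ?O" for n unfolding A_def by (rule inv'(5)[OF O])
    then show "(\<lambda>n. measure M (A n)) \<longlonglongrightarrow> measure M ?O" by simp
  qed
  moreover have "measure M {p} \<le> measure M ?O"
    using O by (intro finite_measure_mono) (auto simp: orbit intro: exI[of _ 0])
  ultimately show ?thesis using pos by linarith
qed

text \<open>By invariance, the expected frequency of ones among the first \<open>n\<close> symbols
  is \<open>measure M E\<close> for every \<open>n > 0\<close>. The frequency tends to 0 almost
  everywhere and is at most 1, so dominated convergence gives
  \<open>measure M E = 0\<close>.\<close>

lemma AE_sparse_imp_zero:
  assumes inv: "invariant_prob_on S M" and S: "zero_word \<in> S" and sparse: "AE x in M. sparse x"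
  shows "measure M {zero_word} = 1"
proof -
  note inv' = invariant_prob_onD[OF inv]
  interpret prob_space M by (rule inv'(2))
  define E where "E = {x. x 0} \<inter> S"
  have sets: "sets M = sets (restrict_space borel S)" using inv by (simp add: invariant_prob_on_def)
  have "open {x :: bool word. x 0}"
    using open_cylinder[of 1 0 "\<lambda>_. True"] by simp
  then have E: "E \<in> sets M" unfolding sets sets_restrict_space E_def
    by (intro image_eqI[of _ _ "{x. x 0}"] borel_open) (simp_all add: Int_commute)
  define E' where "E' j = suffix j -` E \<inter> S" for j
  have E': "E' j \<in> sets M" for j
    using measurable_sets[OF inv'(4) E] unfolding E'_def inv'(1) .
  have meas_E': "measure M (E' j) = measure M E" for j
    unfolding E'_def by (rule inv'(5)[OF E])
  have S_suffix: "suffix j x \<in> S" if "x \<in> S" for x j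
    using measurable_space[OF inv'(4)] that inv'(1) by auto
  have in_E': "x \<in> E' j \<longleftrightarrow> x j" if "x \<in> S" for x j
    using S_suffix[OF that, of j] that by (simp add: E'_def E_def)
  let ?s = "\<lambda>n x. (\<Sum>j<n. indicator (E' j) x) / real n :: real"
  have s_eq: "?s n x = real (ones_before n x) / real n" if "x \<in> S" for n x
  proof -
    have "(\<Sum>j<n. indicator (E' j) x) = (\<Sum>j<n. if x j then 1 else 0 :: real)"
      using in_E'[OF that] by (intro sum.cong) (auto simp: indicator_def)
    then show ?thesis by (simp add: sum.If_cases Int_def)
  qed
  have "(\<lambda>n. integral\<^sup>L M (?s n)) \<longlonglongrightarrow> integral\<^sup>L M (\<lambda>_. 0)"
  proof (rule integral_dominated_convergence[where w = "\<lambda>_. 1"])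
    show "AE x in M. (\<lambda>n. ?s n x) \<longlonglongrightarrow> 0"
      using sparse AE_space
    proof eventually_elim
      case (elim x)
      then show ?case unfolding sparse_def inv'(1) by (simp only: s_eq)
    qed
    show "AE x in M. norm (?s n x) \<le> 1" for n
      using AE_space
    proof eventually_elim
      case (elim x)
      then show ?case using s_eq[of x n] ones_before_le[of n x] by (auto simp: inv'(1) divide_le_eq)
    qed
  qed (use E' in auto)
  moreover have "\<forall>\<^sub>F n in sequentially. integral\<^sup>L M (?s n) = measure M E"
    using eventually_gt_at_top[of 0]
  proof eventually_elim
    case (elim n)
    have "integral\<^sup>L M (?s n) = (\<Sum>j<n. measure M (E' j)) / real n"
      using E' by (subst integral_divide_zero, subst Bochner_Integration.integral_sum) (auto simp: less_top[symmetric] intro!: integrable_real_indicator)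
    then show ?case using elim by (simp add: meas_E')
  qed
  ultimately have "(\<lambda>n. measure M E) \<longlonglongrightarrow> 0"
    by (simp add: tendsto_cong)
  then have "measure M E = 0" by (simp add: LIMSEQ_const_iff)
  then have "E' j \<in> null_sets M" for j
    using meas_E'[of j] E' by (simp add: null_sets_def emeasure_eq_measure)
  \<comment> \<open>\<open>E' j\<close> consists of the points of \<open>S\<close> with a 1 at place
    \<open>j\<close>, so this union is the complement of \<open>{zero_word}\<close> in
    \<open>S\<close>.\<close>
  then have "(\<Union>j. E' j) \<in> null_sets M" by blast
  then have "measure M (space M - (\<Union>j. E' j)) = 1"
    using prob_compl[of "\<Union>j. E' j"] by (simp add: measure_eq_0_null_sets null_setsD2)
  moreover have "space M - (\<Union>j. E' j) = {zero_word}"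
    using in_E' S by (auto simp: inv'(1) zero_word_def fun_eq_iff)
  ultimately show ?thesis by simp
qed

text \<open>If no periodic orbit carries the measure, there are no periodic atoms and almost every
  point is sparse. The mass then sits at \<open>zero_word\<close>, itself a periodic point, which is
  the contradiction.\<close>

lemma ergodic_X_lim_periodic:
  assumes M: "ergodic_prob_on X_lim M"
  shows "\<exists>p\<in>X_lim. periodic_point p \<and> measure M (orbit_of p) = 1"
proof (rule ccontr)
  assume contra: "\<not> ?thesis"
  have inv: "invariant_prob_on X_lim M" using M by (simp add: ergodic_prob_on_def)
  note inv' = invariant_prob_onD[OF inv]
  interpret prob_space M by (rule inv'(2))
  let ?P = "{x \<in> X_lim. periodic_point x}"
  have "{p} \<in> null_sets M" if "p \<in> ?P" for p
  proof -
    have "\<not> measure M {p} > 0"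
      using contra that ergodic_atom_orbit[OF M suffix_X_lim] by blast
    moreover have "{p} \<in> sets M"
      using that by (intro inv'(3) borel_closed closed_singleton_word) auto
    ultimately show ?thesis
      by (simp add: null_sets_def emeasure_eq_measure zero_less_measure_iff)
  qed
  moreover have "countable ?P" using countable_periodic_points by (rule countable_subset[rotated]) auto
  ultimately have "(\<Union>p\<in>?P. {p}) \<in> null_sets M" by (intro null_sets_UN') auto
  then have P: "?P \<in> null_sets M" by simp
  \<comment> \<open>Invariance carries nullity from the periodic points over to the eventually
    periodic ones.\<close>
  have "suffix a -` ?P \<inter> X_lim \<in> null_sets M" for a
    using P inv'(5)[of ?P a] measurable_sets[OF inv'(4), of ?P a]
    by (simp add: null_sets_def emeasure_eq_measure inv'(1))
  then have null: "(\<Union>a. suffix a -` ?P \<inter> X_lim) \<in> null_sets M" by blast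
  have "AE x in M. sparse x"
  proof (rule AE_I'[OF null], rule subsetI)
    fix x assume x: "x \<in> {x \<in> space M. \<not> sparse x}"
    then have X: "x \<in> X_lim" by (simp add: inv'(1))
    then obtain a p where "p \<ge> 1" "suffix p (suffix a x) = suffix a x"
      using x X_lim_dichotomy by blast
    then have "suffix a x \<in> ?P"
      using suffix_X_lim[OF X] unfolding periodic_point_def shift_funpow by blast
    then show "x \<in> (\<Union>a. suffix a -` ?P \<inter> X_lim)" using X by blast
  qed
  then have "measure M {zero_word} = 1"
    by (rule AE_sparse_imp_zero[OF inv zero_word_in_X_lim])
  moreover have "suffix j zero_word = zero_word" for j
    by (simp add: fun_eq_iff zero_word_def)
  then have "orbit_of zero_word = {zero_word}" "periodic_point zero_word"
    unfolding orbit_of_def periodic_point_def shift_funpow by auto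
  ultimately show False using contra zero_word_in_X_lim by auto
qed

theorem lemma9:
  shows "(\<forall>x\<in>X_lim. \<exists>M. ergodic_prob_on X_lim M \<and> generic_for X_lim x M) \<and>
         (\<forall>M. ergodic_prob_on X_lim M \<longrightarrow>
            (\<exists>p\<in>X_lim. periodic_point p \<and> measure M (orbit_of p) = 1))"
  using X_lim_generic ergodic_X_lim_periodic by blast

end
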